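(* Let $\Gamma=\mathbb Z/2\wr\mathbb Z=\langle a,t\mid a^2,\ [a,t^nat^{-n}],\ n\in\mathbb Z\rangle$ be the lamplighter group and $S=\{a,t\}$. Then the stability radius growth of $\Gamma$ with respect to $S$ is at least linear, $\mathrm{SRad}^S_\Gamma(x)\succeq x$; that is, there is a constant $C\ge1$ such that $$x\le C\cdot\mathrm{SRad}^S_\Gamma(Cx)\qquad\text{for all } x>0 .$$
   Context: $\mathbb N=\{1,2,\dots\}$. $U(d)$ is the group of $d\times d$ unitary matrices, $\|A\|_{\mathrm{HS}}=\sqrt{\frac1d\operatorname{Tr}(A^*A)}$ is the normalized Hilbert--Schmidt norm. For $r\in\mathbb N$ let $B_S(r)$ be the ball of radius $r$ around the identity in the word metric of $\Gamma$ with respect to $S$. Local defect: for $\varphi:B_S(r)\to U(d)$, $L_{S,r}(\varphi)=\max\{\|\varphi(gh)-\varphi(g)\varphi(h)\|_{\mathrm{HS}} : g,h,gh\in B_S(r)\}$. Global defect: $G_S(\varphi)=\inf_\pi\max_{g\in S}\|\varphi(g)-\pi(g)\|_{\mathrm{HS}}$, the infimum being over all unitary representations $\pi:\Gamma\to U(d)$. Stability rate: for $\kappa>0$, $\mathrm{SRate}^{S,r}_\Gamma(\kappa)$ is the supremum (in $[0,\infty]$) of all $\delta>0$ such that for every $d\in\mathbb N$ and every $\varphi:B_S(r)\to U(d)$ with $L_{S,r}(\varphi)<\delta$ one has $G_S(\varphi)<\kappa$; it is $0$ if no such $\delta>0$ exists. Stability radius growth: for real $x>0$, $\mathrm{SRad}^S_\Gamma(x)=\min\{r\in\mathbb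 N:\mathrm{SRate}^{S,r}_\Gamma(1/x)>0\}$, and $\mathrm{SRad}^S_\Gamma(x)=\infty$ if no such $r$ exists. *)

theory Defs
  imports
    Complex_Main
    "HOL-Library.Z2"
    "HOL-Library.Extended_Nonnegative_Real"
    "HOL-Algebra.Generated_Groups"
    "Jordan_Normal_Form.Schur_Decomposition"
begin

section \<open>Unitary matrices and the normalized Hilbert--Schmidt norm\<close>

definition unitary_group :: "nat \<Rightarrow> complex mat monoid" where
  "unitary_group d =
     \<lparr>carrier = {A \<in> carrier_mat d d. mat_adjoint A * A = 1\<^sub>m d \<and> A * mat_adjoint A = 1\<^sub>m d},
      monoid.mult = (*), one = 1\<^sub>m d\<rparr>"

definition mat_trace :: "complex mat \<Rightarrow> complex" where
  "mat_trace A = (\<Sum>i<dim_row A. A $$ (i, i))"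

text \<open>The trace below is a non-negative real number, so taking its real part is only a coercion.\<close>

definition hs_norm :: "complex mat \<Rightarrow> real" where
  "hs_norm A = sqrt (1 / real (dim_row A) * Re (mat_trace (mat_adjoint A * A)))"


section \<open>Word metric\<close>

text \<open>The distance is \<open>\<infinity>\<close> between elements that differ by no product of generators and their
  inverses.\<close>

definition word_dist :: "('g, 'm) monoid_scheme \<Rightarrow> 'g set \<Rightarrow> 'g \<Rightarrow> 'g \<Rightarrow> enat" where
  "word_dist G S g h =
     (INF w \<in> {w \<in> lists (S \<union> m_inv G ` S). foldr (monoid.mult G) w \<one>\<^bsub>G\<^esub> = inv\<^bsub>G\<^esub> g \<otimes>\<^bsub>G\<^esub> h}.
        enat (length w))"

definition word_ball :: "('g, 'm) monoid_scheme \<Rightarrow> 'g set \<Rightarrow> nat \<Rightarrow> 'g set" where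
  "word_ball G S r = {g \<in> carrier G. word_dist G S \<one>\<^bsub>G\<^esub> g \<le> enat r}"

lemma (in group) word_ball_iff:
  assumes "S \<subseteq> carrier G"
  shows "g \<in> word_ball G S r \<longleftrightarrow>
    (\<exists>w \<in> lists (S \<union> m_inv G ` S). length w \<le> r \<and> foldr (monoid.mult G) w \<one> = g)"
proof -
  define W where "W g = {w \<in> lists (S \<union> m_inv G ` S). foldr (monoid.mult G) w \<one> = g}" for g
  have closed: "foldr (monoid.mult G) w \<one> \<in> carrier G" if "w \<in> lists (S \<union> m_inv G ` S)" for w
    using that by induction (use assms in auto)
  have d: "word_dist G S \<one> g = (INF w \<in> W g. enat (length w))" if "g \<in> carrier G" for g
    using that by (simp add: word_dist_def W_def)
  have *: "(INF w \<in> W g. enat (length w)) \<le> enat r \<longleftrightarrow> (\<exists>w \<in> W g. length w \<le> r)"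
  proof
    assume le: "(INF w \<in> W g. enat (length w)) \<le> enat r"
    then have "W g \<noteq> {}"
      by (auto simp: top_enat_def)
    then have "(INF w \<in> W g. enat (length w)) \<in> (\<lambda>w. enat (length w)) ` W g"
      by (metis (no_types, lifting) image_is_empty all_not_in_conv wellorder_InfI)
    with le show "\<exists>w \<in> W g. length w \<le> r" by auto
  qed (auto intro: INF_lower2)
  have "g \<in> carrier G" if "w \<in> W g" for w
    using closed that by (auto simp: W_def)
  then have "g \<in> word_ball G S r \<longleftrightarrow> (\<exists>w \<in> W g. length w \<le> r)"
    using d[of g] * by (auto simp: word_ball_def)
  then show ?thesis
    by (auto simp: W_def)
qed

lemma (in group) finite_word_ball:
  assumes "S \<subseteq> carrier G" "finite S"
  shows "finite (word_ball G S r)"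
proof -
  have "word_ball G S r \<subseteq>
      (\<lambda>w. foldr (monoid.mult G) w \<one>) ` {w. set w \<subseteq> S \<union> m_inv G ` S \<and> length w \<le> r}"
    using assms(1) by (fastforce simp: word_ball_iff)
  moreover have "finite {w. set w \<subseteq> S \<union> m_inv G ` S \<and> length w \<le> r}"
    using assms(2) by (intro finite_lists_length_le) auto
  ultimately show ?thesis
    by (meson finite_imageI finite_subset)
qed


section \<open>Defects, stability rate and stability radius growth\<close>

text \<open>A map defined on a ball is encoded as a total function whose values outside the ball are
  irrelevant. The maxima are over finite sets as soon as \<open>S\<close> is finite.\<close>

definition local_defect ::
  "('g, 'm) monoid_scheme \<Rightarrow> 'g set \<Rightarrow> nat \<Rightarrow> ('g \<Rightarrow> complex mat) \<Rightarrow> real" where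
  "local_defect G S r \<phi> =
     Max {hs_norm (\<phi> (g \<otimes>\<^bsub>G\<^esub> h) - \<phi> g * \<phi> h) | g h.
            g \<in> word_ball G S r \<and> h \<in> word_ball G S r \<and> g \<otimes>\<^bsub>G\<^esub> h \<in> word_ball G S r}"

definition global_defect ::
  "('g, 'm) monoid_scheme \<Rightarrow> 'g set \<Rightarrow> nat \<Rightarrow> ('g \<Rightarrow> complex mat) \<Rightarrow> real" where
  "global_defect G S d \<phi> =
     (INF \<pi> \<in> hom G (unitary_group d). Max ((\<lambda>g. hs_norm (\<phi> g - \<pi> g)) ` S))"

text \<open>In \<^typ>\<open>ennreal\<close> and \<^typ>\<open>enat\<close> we have \<open>Sup {} = 0\<close> and \<open>Inf {} = \<infinity>\<close>, which are
  the values wanted when no admissible \<open>\<delta>\<close> or \<open>r\<close> exists; a non-empty infimum in \<^typ>\<open>enat\<close> is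
  a minimum.\<close>

definition stability_rate ::
  "('g, 'm) monoid_scheme \<Rightarrow> 'g set \<Rightarrow> nat \<Rightarrow> real \<Rightarrow> ennreal" where
  "stability_rate G S r \<kappa> =
     (SUP \<delta> \<in> {\<delta>::real. \<delta> > 0 \<and>
          (\<forall>d\<ge>1. \<forall>\<phi> \<in> word_ball G S r \<rightarrow> carrier (unitary_group d).
              local_defect G S r \<phi> < \<delta> \<longrightarrow> global_defect G S d \<phi> < \<kappa>)}.
        ennreal \<delta>)"

definition stability_radius :: "('g, 'm) monoid_scheme \<Rightarrow> 'g set \<Rightarrow> real \<Rightarrow> enat" where
  "stability_radius G S x = (INF r \<in> {r::nat. r \<ge> 1 \<and> stability_rate G S r (1 / x) > 0}. enat r)"


section \<open>The lamplighter group\<close>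

text \<open>The restricted wreath product \<open>\<int>/2 \<wr> \<int>\<close>, i.e. the semidirect product of the finitely supported
  functions \<open>\<int> \<rightarrow> \<int>/2\<close> with \<open>\<int>\<close> acting by translation.\<close>

definition lamplighter :: "((int \<Rightarrow> bit) \<times> int) monoid" where
  "lamplighter =
     \<lparr>carrier = {f. finite {i. f i \<noteq> 0}} \<times> UNIV,
      monoid.mult = (\<lambda>(f, m) (g, n). (\<lambda>i. f i + g (i - m), m + n)),
      one = (\<lambda>_. 0, 0)\<rparr>"

definition lamp_a :: "(int \<Rightarrow> bit) \<times> int" where
  "lamp_a = (\<lambda>i. if i = 0 then 1 else 0, 0)"

definition lamp_t :: "(int \<Rightarrow> bit) \<times> int" where
  "lamp_t = (\<lambda>_. 0, 1)"

lemma finite_support_add: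
  fixes f g :: "int \<Rightarrow> bit"
  assumes "finite {i. f i \<noteq> 0}" "finite {i. g i \<noteq> 0}"
  shows "finite {i. f i + g (i - m) \<noteq> 0}"
proof -
  have "{i. f i + g (i - m) \<noteq> 0} \<subseteq> {i. f i \<noteq> 0} \<union> (\<lambda>i. i + m) ` {i. g i \<noteq> 0}"
  proof
    fix i assume "i \<in> {i. f i + g (i - m) \<noteq> 0}"
    then have "f i \<noteq> 0 \<or> g (i - m) \<noteq> 0" by auto
    then show "i \<in> {i. f i \<noteq> 0} \<union> (\<lambda>i. i + m) ` {i. g i \<noteq> 0}"
      by (metis (mono_tags, lifting) UnI1 UnI2 diff_add_cancel image_eqI mem_Collect_eq)
  qed
  then show ?thesis
    using assms by (meson finite_UnI finite_imageI finite_subset)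
qed

lemma group_lamplighter: "group lamplighter"
proof (rule groupI)
  fix x assume x: "x \<in> carrier lamplighter"
  obtain f m where fm: "x = (f, m)" by fastforce
  have "finite ((\<lambda>i. i - m) ` {i. f i \<noteq> 0})"
    using x fm by (auto simp: lamplighter_def)
  moreover have "{i. f (i + m) \<noteq> 0} = (\<lambda>i. i - m) ` {i. f i \<noteq> 0}"
    by (auto simp: image_iff intro!: exI[of _ "_ + m"])
  ultimately have "(\<lambda>i. f (i + m), - m) \<in> carrier lamplighter"
    by (simp add: lamplighter_def)
  then show "\<exists>y\<in>carrier lamplighter. y \<otimes>\<^bsub>lamplighter\<^esub> x = \<one>\<^bsub>lamplighter\<^esub>"
    by (rule bexI[rotated]) (auto simp: fm lamplighter_def fun_eq_iff)
next
  fix x y assume "x \<in> carrier lamplighter" "y \<in> carrier lamplighter"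
  then show "x \<otimes>\<^bsub>lamplighter\<^esub> y \<in> carrier lamplighter"
    using finite_support_add
    by (auto simp: lamplighter_def simp del: add_bit_eq_xor bit_not_zero_iff bit_not_one_iff)
qed (auto simp: lamplighter_def fun_eq_iff algebra_simps)

lemma lamp_gens_closed: "{lamp_a, lamp_t} \<subseteq> carrier lamplighter"
  by (auto simp: lamplighter_def lamp_a_def lamp_t_def)

lemma lamp_t_power: "lamp_t [^]\<^bsub>lamplighter\<^esub> (n::int) = (\<lambda>_. 0, n)"
proof -
  interpret group lamplighter by (rule group_lamplighter)
  have nat: "lamp_t [^]\<^bsub>lamplighter\<^esub> k = (\<lambda>_. 0, int k)" for k :: nat
    by (induction k) (auto simp: lamp_t_def lamplighter_def)
  have "inv\<^bsub>lamplighter\<^esub> (\<lambda>_. 0, k) = (\<lambda>_. 0, - k)" for k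
    by (rule inv_equality) (auto simp: lamplighter_def)
  then show ?thesis
    by (auto simp: int_pow_def2 nat)
qed

lemma lamp_conj:
  "lamp_t [^]\<^bsub>lamplighter\<^esub> (n::int) \<otimes>\<^bsub>lamplighter\<^esub> lamp_a \<otimes>\<^bsub>lamplighter\<^esub>
     lamp_t [^]\<^bsub>lamplighter\<^esub> (- n) = (\<lambda>i. if i = n then 1 else 0, 0)"
  unfolding lamp_t_power by (auto simp: lamp_a_def lamplighter_def fun_eq_iff)

text \<open>The defining relations of the presentation \<open>\<langle>a, t | a\<^sup>2, [a, t\<^sup>n a t\<^sup>-\<^sup>n]\<rangle>\<close>.\<close>

lemma lamplighter_relations:
  "lamp_a \<otimes>\<^bsub>lamplighter\<^esub> lamp_a = \<one>\<^bsub>lamplighter\<^esub>"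
  "let b = lamp_t [^]\<^bsub>lamplighter\<^esub> (n::int) \<otimes>\<^bsub>lamplighter\<^esub> lamp_a \<otimes>\<^bsub>lamplighter\<^esub>
             lamp_t [^]\<^bsub>lamplighter\<^esub> (- n)
   in lamp_a \<otimes>\<^bsub>lamplighter\<^esub> b = b \<otimes>\<^bsub>lamplighter\<^esub> lamp_a"
  unfolding lamp_conj Let_def by (auto simp: lamp_a_def lamplighter_def fun_eq_iff)

lemma generate_lamplighter: "generate lamplighter {lamp_a, lamp_t} = carrier lamplighter"
proof -
  interpret group lamplighter by (rule group_lamplighter)
  let ?H = "generate lamplighter {lamp_a, lamp_t}"
  interpret H: subgroup ?H lamplighter
    by (rule generate_is_subgroup[OF lamp_gens_closed])
  have a: "lamp_a \<in> ?H" and t: "lamp_t \<in> ?H"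
    by (auto intro: generate.incl)
  have pow: "lamp_t [^]\<^bsub>lamplighter\<^esub> (n::int) \<in> ?H" for n
    using t by (simp add: H.subgroup_axioms subgroup_int_pow_closed)
  have delta: "(\<lambda>i. if i = n then 1 else 0, 0) \<in> ?H" for n
    unfolding lamp_conj[symmetric] using a pow by blast
  have "(f, 0) \<in> ?H" if "finite A" "{i. f i \<noteq> 0} = A" for f A
    using that
  proof (induction A arbitrary: f rule: finite_induct)
    case empty
    then have "(f, 0) = \<one>\<^bsub>lamplighter\<^esub>"
      by (auto simp: lamplighter_def)
    then show ?case by simp
  next
    case (insert n A)
    define g where "g = f(n := 0)"
    have "{i. g i \<noteq> 0} = A"
      using insert.hyps insert.prems by (auto simp: g_def)
    then have "(g, 0) \<in> ?H"
      by (rule insert.IH)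
    moreover have "f n \<noteq> 0" using insert.prems by auto
    then have "(f, 0) = (\<lambda>i. if i = n then 1 else 0, 0) \<otimes>\<^bsub>lamplighter\<^esub> (g, 0)"
      by (auto simp: lamplighter_def g_def fun_eq_iff)
    ultimately show ?case
      using delta[of n] by simp
  qed
  then have base: "(f, 0) \<in> ?H" if "finite {i. f i \<noteq> 0}" for f
    using that by blast
  have split: "(f, n) = (f, 0) \<otimes>\<^bsub>lamplighter\<^esub> lamp_t [^]\<^bsub>lamplighter\<^esub> n" for f n
    unfolding lamp_t_power by (auto simp: lamplighter_def)
  have "(f, n) \<in> ?H" if "finite {i. f i \<noteq> 0}" for f n
    unfolding split[of f n] by (intro H.m_closed base pow that)
  then have "carrier lamplighter \<subseteq> ?H"
    unfolding lamplighter_def[THEN arg_cong[of _ _ carrier]] by auto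
  then show ?thesis
    using H.subset by blast
qed

end

theory Submission
  imports Defs "HOL-Analysis.L2_Norm"
begin

text \<open>
  Write \<open>a\<^sub>n = t\<^sup>n a t\<^sup>-\<^sup>n\<close>. The ball of radius \<open>r\<close> only sees the relations
  \<open>[a\<^sub>i, a\<^sub>j] = 1\<close> with \<open>\<bar>i - j\<bar> \<le> 2r\<close>. So a group in which these hold but
  \<open>a\<^sub>0\<close> and \<open>a\<^sub>M\<close>, with \<open>M = 2r + 1\<close>, do not commute yields maps on the ball that are
  exactly multiplicative and yet far from every representation. Indeed, in a representation of the
  lamplighter group \<open>[a, t\<^sup>M a t\<^sup>-\<^sup>M]\<close> is trivial, and it is a word with \<open>4M + 4\<close> letters; moving
  \<open>a\<close> and \<open>t\<close> by less than \<open>\<kappa>\<close> in Hilbert--Schmidt norm moves the value of this word by at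
  most \<open>(4M + 4) \<kappa>\<close> (\<open>hs_norm_commutator_le\<close>). If the word was at distance at least \<open>1\<close> from the
  identity, then \<open>\<kappa> \<ge> 1 / (4M + 4) = 1 / (8r + 8)\<close>. Hence the stability rate on the ball of
  radius \<open>r\<close> vanishes for \<open>\<kappa> \<le> 1 / (8r + 8)\<close>, and this is the linear lower bound.

  The group used is a finite one. Reduce the lamp positions modulo \<open>K = 4r + 3\<close> and
  replace the lamp group \<open>(\<int>/2)\<^sup>K\<close> by its central extension by \<open>\<int>/2\<close> with the bilinear cocycle
  \<open>\<beta>(v, w) = \<Sum>\<^sub>i v\<^sub>i w\<^sub>i\<^sub>+\<^sub>M\<close>, indices modulo \<open>K\<close>. The generators at \<open>i\<close> and \<open>j\<close> then fail to
  commute exactly if \<open>i - j\<close> is \<open>\<plusminus>M\<close> modulo \<open>K\<close>, in which case their commutator is the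
  central element. The cyclic shift preserves \<open>\<beta>\<close>, so it acts on the extension, and
  the extension together with the shift acts on the underlying finite set of the extension
  (\<open>twisted_shift\<close>). The central element moves every point, so in the permutation representation
  the two orders of multiplication are far apart (\<open>hs_norm_perm_mat_diff\<close>), although the dimension
  is exponential in \<open>r\<close>. Finally \<open>\<beta>\<close> vanishes on pairs of configurations supported in the
  window \<open>[-r, r]\<close> (\<open>cyclic_pairing_window\<close>), so the section of the extension that puts \<open>0\<close> in
  the centre is multiplicative there.
\<close>

text \<open>Bits are treated below as elements of a field, not as truth values.\<close>

declare bit_not_zero_iff [simp del] bit_not_one_iff [simp del]
  add_bit_eq_xor [simp del] mult_bit_eq_and [simp del]

section \<open>The normalized Hilbert--Schmidt norm\<close>

lemma mat_adjoint_dim [simp]: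
  "dim_row (mat_adjoint A) = dim_col A" "dim_col (mat_adjoint A) = dim_row A"
  by (simp_all add: mat_adjoint_def)

lemma mat_adjoint_carrier [simp]: "A \<in> carrier_mat n m \<Longrightarrow> mat_adjoint A \<in> carrier_mat m n"
  by (rule carrier_matI) simp_all

lemma mat_adjoint_index [simp]:
  "i < dim_col A \<Longrightarrow> j < dim_row A \<Longrightarrow> (mat_adjoint A :: complex mat) $$ (i, j) = cnj (A $$ (j, i))"
  by (simp add: mat_adjoint_def mat_of_rows_index)

lemma mat_adjoint_mult:
  fixes A B :: "complex mat"
  assumes "A \<in> carrier_mat n m" "B \<in> carrier_mat m k"
  shows "mat_adjoint (A * B) = mat_adjoint B * mat_adjoint A"
proof (rule eq_matI)
  show "dim_row (mat_adjoint (A * B)) = dim_row (mat_adjoint B * mat_adjoint A)"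
    "dim_col (mat_adjoint (A * B)) = dim_col (mat_adjoint B * mat_adjoint A)"
    using assms by auto
  fix i j assume "i < dim_row (mat_adjoint B * mat_adjoint A)"
    "j < dim_col (mat_adjoint B * mat_adjoint A)"
  then have ij: "i < k" "j < n" using assms by auto
  have "mat_adjoint (A * B) $$ (i, j) = cnj ((A * B) $$ (j, i))"
    using assms ij by simp
  also have "\<dots> = (\<Sum>l<m. cnj (A $$ (j, l)) * cnj (B $$ (l, i)))"
    using assms ij by (auto simp: scalar_prod_def atLeast0LessThan intro!: sum.cong)
  also have "\<dots> = (mat_adjoint B * mat_adjoint A) $$ (i, j)"
    using assms ij by (auto simp: scalar_prod_def atLeast0LessThan intro!: sum.cong)
  finally show "mat_adjoint (A * B) $$ (i, j) = (mat_adjoint B * mat_adjoint A) $$ (i, j)" .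
qed

lemma mat_adjoint_adjoint:
  fixes A :: "complex mat"
  shows "mat_adjoint (mat_adjoint A) = A"
  by (rule eq_matI) auto

text \<open>In this form the triangle inequality is that of the Euclidean norm, and invariance under
  the adjoint is visible.\<close>

lemma hs_norm_eq:
  assumes A: "A \<in> carrier_mat d d"
  shows "hs_norm A = L2_set (\<lambda>(i, j). cmod (A $$ (i, j))) ({..<d} \<times> {..<d}) / sqrt d"
proof -
  have "mat_trace (mat_adjoint A * A) = (\<Sum>j<d. \<Sum>i<d. cnj (A $$ (i, j)) * A $$ (i, j))"
    using A unfolding mat_trace_def
    by (auto simp: scalar_prod_def atLeast0LessThan intro!: sum.cong)
  also have "Re \<dots> = (\<Sum>j<d. \<Sum>i<d. (cmod (A $$ (i, j)))\<^sup>2)"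
    by (simp add: cmod_power2) (simp add: power2_eq_square)
  also have "\<dots> = (\<Sum>(i, j)\<in>{..<d} \<times> {..<d}. (cmod (A $$ (i, j)))\<^sup>2)"
    by (subst sum.swap) (simp add: sum.cartesian_product)
  finally show ?thesis
    using A by (simp add: hs_norm_def L2_set_def case_prod_unfold real_sqrt_divide)
qed

lemma hs_norm_zero: "hs_norm (0\<^sub>m d d) = 0"
  by (subst hs_norm_eq[of _ d]) (auto intro: L2_set_0')

lemma hs_norm_triangle:
  assumes "A \<in> carrier_mat d d" "B \<in> carrier_mat d d" "C \<in> carrier_mat d d"
  shows "hs_norm (A - C) \<le> hs_norm (A - B) + hs_norm (B - C)"
proof -
  let ?D = "{..<d} \<times> {..<d}"
  let ?l = "\<lambda>M. L2_set (\<lambda>(i, j). cmod (M $$ (i, j))) ?D"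
  have tri: "cmod (x - z) \<le> cmod (x - y) + cmod (y - z)" for x y z
    by (rule norm_diff_triangle_le[OF order_refl order_refl])
  have "?l (A - C) \<le> L2_set (\<lambda>p. (case p of (i, j) \<Rightarrow> cmod ((A - B) $$ (i, j))) +
      (case p of (i, j) \<Rightarrow> cmod ((B - C) $$ (i, j)))) ?D"
    using assms tri by (intro L2_set_mono) auto
  also have "\<dots> \<le> ?l (A - B) + ?l (B - C)"
    by (rule L2_set_triangle_ineq)
  finally show ?thesis
    using assms
    by (simp add: hs_norm_eq[of _ d] minus_carrier_mat divide_right_mono flip: add_divide_distrib)
qed

lemma hs_norm_adjoint:
  assumes A: "A \<in> carrier_mat d d"
  shows "hs_norm (mat_adjoint A) = hs_norm A"
proof -
  have "L2_set (\<lambda>(i, j). cmod (mat_adjoint A $$ (i, j))) ({..<d} \<times> {..<d}) =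
      L2_set (\<lambda>(i, j). cmod (A $$ (i, j))) ({..<d} \<times> {..<d})"
    unfolding L2_set_def
    by (rule arg_cong[where f = sqrt], rule sum.reindex_bij_witness[where i = prod.swap and j = prod.swap])
      (use A in auto)
  then show ?thesis
    using A by (simp add: hs_norm_eq[of _ d])
qed

lemma unitary_group_carrier:
  "U \<in> carrier (unitary_group d) \<longleftrightarrow>
    U \<in> carrier_mat d d \<and> mat_adjoint U * U = 1\<^sub>m d \<and> U * mat_adjoint U = 1\<^sub>m d"
  by (simp add: unitary_group_def)

lemma hs_norm_unitary_left:
  assumes U: "U \<in> carrier (unitary_group d)" and A: "A \<in> carrier_mat d d"
  shows "hs_norm (U * A) = hs_norm A"
proof -
  have U': "U \<in> carrier_mat d d" "mat_adjoint U \<in> carrier_mat d d" "mat_adjoint U * U = 1\<^sub>m d"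
    using U by (auto simp: unitary_group_carrier)
  have A': "mat_adjoint A \<in> carrier_mat d d" using A by simp
  have "mat_adjoint (U * A) * (U * A) = mat_adjoint A * (mat_adjoint U * (U * A))"
    using U' A A' by (simp add: mat_adjoint_mult[of _ d d _ d] assoc_mult_mat[of _ d d _ d _ d])
  also have "mat_adjoint U * (U * A) = A"
    using U' A by (simp flip: assoc_mult_mat[of _ d d _ d _ d])
  finally show ?thesis
    using U' A by (simp add: hs_norm_def)
qed

lemma unitary_adjoint:
  "U \<in> carrier (unitary_group d) \<Longrightarrow> mat_adjoint U \<in> carrier (unitary_group d)"
  by (auto simp: unitary_group_carrier mat_adjoint_adjoint)

lemma hs_norm_unitary_right:
  assumes U: "U \<in> carrier (unitary_group d)" and A: "A \<in> carrier_mat d d"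
  shows "hs_norm (A * U) = hs_norm A"
proof -
  have U': "U \<in> carrier_mat d d" using U by (simp add: unitary_group_carrier)
  have "hs_norm (A * U) = hs_norm (mat_adjoint (A * U))"
    using U' A by (simp add: hs_norm_adjoint[of _ d])
  also have "\<dots> = hs_norm (mat_adjoint U * mat_adjoint A)"
    using U' A by (simp add: mat_adjoint_mult)
  also have "\<dots> = hs_norm A"
    using hs_norm_unitary_left[OF unitary_adjoint[OF U]] A by (simp add: hs_norm_adjoint)
  finally show ?thesis .
qed

lemma hs_norm_mult_diff:
  assumes U: "U \<in> carrier_mat d d" "V \<in> carrier (unitary_group d)"
    and U': "U' \<in> carrier (unitary_group d)" "V' \<in> carrier_mat d d"
  shows "hs_norm (U * V - U' * V') \<le> hs_norm (U - U') + hs_norm (V - V')"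
proof -
  have c: "V \<in> carrier_mat d d" "U' \<in> carrier_mat d d"
    using U U' by (auto simp: unitary_group_carrier)
  have "hs_norm (U * V - U' * V') \<le> hs_norm (U * V - U' * V) + hs_norm (U' * V - U' * V')"
    using U U' c by (intro hs_norm_triangle) auto
  moreover have "U * V - U' * V = (U - U') * V" "U' * V - U' * V' = U' * (V - V')"
    using U U' c by (auto simp: minus_mult_distrib_mat mult_minus_distrib_mat)
  ultimately show ?thesis
    using U U' c by (simp add: hs_norm_unitary_left hs_norm_unitary_right minus_carrier_mat)
qed

lemma hs_norm_commute:
  assumes "A \<in> carrier_mat d d" "B \<in> carrier_mat d d"
  shows "hs_norm (A - B) = hs_norm (B - A)"
proof -
  have "L2_set (\<lambda>(i, j). cmod ((A - B) $$ (i, j))) ({..<d} \<times> {..<d}) =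
      L2_set (\<lambda>(i, j). cmod ((B - A) $$ (i, j))) ({..<d} \<times> {..<d})"
    using assms by (intro L2_set_cong) (auto simp: norm_minus_commute)
  then show ?thesis
    using assms by (simp add: hs_norm_eq[of _ d] minus_carrier_mat)
qed

text \<open>The relation \<open>C T = T B\<close> says that \<open>C\<close> is the conjugate \<open>T B T\<^sup>-\<^sup>1\<close>. Multiplying
  \<open>C - C'\<close> by \<open>T\<close> on the right brings the relation into play without inverses; each of the
  two letters \<open>T\<close>, \<open>T\<^sup>-\<^sup>1\<close> costs one distance between \<open>T\<close> and \<open>T'\<close>.\<close>

lemma hs_norm_unitary_conj_diff:
  assumes u: "B \<in> carrier (unitary_group d)" "T \<in> carrier (unitary_group d)"
      "C \<in> carrier_mat d d" "B' \<in> carrier_mat d d" "T' \<in> carrier (unitary_group d)"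
      "C' \<in> carrier (unitary_group d)"
    and conj: "C * T = T * B" "C' * T' = T' * B'"
  shows "hs_norm (C - C') \<le> hs_norm (B - B') + 2 * hs_norm (T - T')"
proof -
  have c: "B \<in> carrier_mat d d" "T \<in> carrier_mat d d" "T' \<in> carrier_mat d d" "C' \<in> carrier_mat d d"
    using u by (auto simp: unitary_group_carrier)
  have "hs_norm (C - C') = hs_norm ((C - C') * T)"
    using u c by (simp add: hs_norm_unitary_right minus_carrier_mat)
  also have "(C - C') * T = C * T - C' * T"
    using u c by (simp add: minus_mult_distrib_mat)
  also have "hs_norm \<dots> \<le> hs_norm (C * T - C' * T') + hs_norm (C' * T' - C' * T)"
    using u c by (intro hs_norm_triangle) auto
  also have "C' * T' - C' * T = C' * (T' - T)"
    using u c by (simp add: mult_minus_distrib_mat)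
  also have "hs_norm (C' * (T' - T)) = hs_norm (T - T')"
    using u c by (simp add: hs_norm_unitary_left minus_carrier_mat hs_norm_commute)
  also have "hs_norm (C * T - C' * T') \<le> hs_norm (T - T') + hs_norm (B - B')"
    unfolding conj by (rule hs_norm_mult_diff) (use u c in auto)
  finally show ?thesis by simp
qed


section \<open>Permutation matrices\<close>

definition perm_mat :: "nat \<Rightarrow> (nat \<Rightarrow> 'x) \<Rightarrow> ('x \<Rightarrow> 'x) \<Rightarrow> complex mat" where
  "perm_mat d e \<sigma> = mat d d (\<lambda>(i, j). if e i = \<sigma> (e j) then 1 else 0)"

lemma perm_mat_carrier [simp]: "perm_mat d e \<sigma> \<in> carrier_mat d d"
  by (simp add: perm_mat_def)

lemma perm_mat_mult:
  assumes e: "bij_betw e {..<d} X" and \<tau>: "\<tau> \<in> X \<rightarrow> X"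
  shows "perm_mat d e \<sigma> * perm_mat d e \<tau> = perm_mat d e (\<sigma> \<circ> \<tau>)"
proof (rule eq_matI)
  fix i j assume "i < dim_row (perm_mat d e (\<sigma> \<circ> \<tau>))" "j < dim_col (perm_mat d e (\<sigma> \<circ> \<tau>))"
  then have ij: "i < d" "j < d" by (auto simp: perm_mat_def)
  then have "\<tau> (e j) \<in> X"
    using e \<tau> by (auto simp: bij_betw_def)
  then obtain l where l: "l < d" "e l = \<tau> (e j)"
    using e by (auto simp: bij_betw_def)
  have l_iff: "e k = \<tau> (e j) \<longleftrightarrow> k = l" if "k < d" for k
    using that l e by (auto simp: bij_betw_def inj_on_def)
  have "(perm_mat d e \<sigma> * perm_mat d e \<tau>) $$ (i, j) =
      (\<Sum>k<d. (if e i = \<sigma> (e k) then 1 else 0) * (if e k = \<tau> (e j) then 1 else 0))"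
    using ij by (auto simp: perm_mat_def scalar_prod_def atLeast0LessThan intro!: sum.cong)
  also have "\<dots> = (\<Sum>k<d. if k = l then (if e i = \<sigma> (e l) then 1 else 0) else 0)"
    by (rule sum.cong) (auto simp: l_iff)
  also have "\<dots> = perm_mat d e (\<sigma> \<circ> \<tau>) $$ (i, j)"
    using ij l by (simp add: perm_mat_def)
  finally show "(perm_mat d e \<sigma> * perm_mat d e \<tau>) $$ (i, j) = perm_mat d e (\<sigma> \<circ> \<tau>) $$ (i, j)" .
qed (auto simp: perm_mat_def)

lemma perm_mat_unitary:
  assumes e: "bij_betw e {..<d} X" and \<sigma>: "\<sigma> \<in> X \<rightarrow> X" "inj_on \<sigma> X"
  shows "perm_mat d e \<sigma> \<in> carrier (unitary_group d)"
proof -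
  let ?P = "perm_mat d e \<sigma>"
  have adj: "mat_adjoint ?P \<in> carrier_mat d d" by simp
  have "mat_adjoint ?P * ?P = 1\<^sub>m d"
  proof (rule eq_matI)
    fix i j assume "i < dim_row (1\<^sub>m d :: complex mat)" "j < dim_col (1\<^sub>m d :: complex mat)"
    then have ij: "i < d" "j < d" by auto
    then have mem: "e i \<in> X" "e j \<in> X" "\<sigma> (e i) \<in> X"
      using e \<sigma> by (auto simp: bij_betw_def)
    then obtain l where l: "l < d" "e l = \<sigma> (e i)"
      using e by (auto simp: bij_betw_def)
    have l_iff: "e k = \<sigma> (e i) \<longleftrightarrow> k = l" if "k < d" for k
      using that l e by (auto simp: bij_betw_def inj_on_def)
    have "(mat_adjoint ?P * ?P) $$ (i, j) =
        (\<Sum>k<d. cnj (?P $$ (k, i)) * ?P $$ (k, j))"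
      using ij by (auto simp: perm_mat_def scalar_prod_def atLeast0LessThan intro!: sum.cong)
    also have "\<dots> = (\<Sum>k<d. if k = l then (if e l = \<sigma> (e j) then 1 else 0) else 0)"
      by (rule sum.cong) (use ij l_iff in \<open>auto simp: perm_mat_def\<close>)
    also have "\<dots> = (if \<sigma> (e i) = \<sigma> (e j) then 1 else 0)"
      using l by simp
    also have "\<dots> = 1\<^sub>m d $$ (i, j)"
      using ij mem \<sigma>(2) e by (auto simp: inj_on_def bij_betw_def)
    finally show "(mat_adjoint ?P * ?P) $$ (i, j) = 1\<^sub>m d $$ (i, j)" .
  qed (auto simp: perm_mat_def)
  with mat_mult_left_right_inverse[OF adj perm_mat_carrier this] show ?thesis
    by (simp add: unitary_group_carrier)
qed

text \<open>The columns indexed by a point that the two permutations send to different images differ by a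
  vector of norm \<open>\<surd>2\<close>, of which one entry suffices here; the normalization by the dimension makes
  the bound independent of it.\<close>

lemma hs_norm_perm_mat_diff:
  assumes e: "bij_betw e {..<d} X" and d: "d > 0"
    and \<sigma>: "\<sigma> \<in> X \<rightarrow> X" and ne: "\<And>x. x \<in> X \<Longrightarrow> \<sigma> x \<noteq> \<tau> x"
  shows "hs_norm (perm_mat d e \<sigma> - perm_mat d e \<tau>) \<ge> 1"
proof -
  let ?D = "perm_mat d e \<sigma> - perm_mat d e \<tau>"
  have "(\<Sum>i<d. (cmod (?D $$ (i, j)))\<^sup>2) \<ge> 1" if j: "j < d" for j
  proof -
    have ej: "e j \<in> X" using e j by (auto simp: bij_betw_def)
    then have "\<sigma> (e j) \<in> X" using \<sigma> by auto
    then obtain l where l: "l < d" "e l = \<sigma> (e j)"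
      using e by (auto simp: bij_betw_def)
    have "1 = (cmod (?D $$ (l, j)))\<^sup>2"
      using l j ne[OF ej] by (simp add: perm_mat_def)
    also have "\<dots> \<le> (\<Sum>i<d. (cmod (?D $$ (i, j)))\<^sup>2)"
      using l by (intro member_le_sum) auto
    finally show ?thesis .
  qed
  then have "(\<Sum>j<d. 1) \<le> (\<Sum>j<d. \<Sum>i<d. (cmod (?D $$ (i, j)))\<^sup>2)"
    by (intro sum_mono) auto
  also have "\<dots> = (\<Sum>(i, j)\<in>{..<d} \<times> {..<d}. (cmod (?D $$ (i, j)))\<^sup>2)"
    by (subst sum.swap) (simp add: sum.cartesian_product)
  finally have "sqrt d \<le> L2_set (\<lambda>(i, j). cmod (?D $$ (i, j))) ({..<d} \<times> {..<d})"
    by (simp add: L2_set_def case_prod_unfold)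
  then show ?thesis
    using d by (subst hs_norm_eq[of _ d]) (auto simp: minus_carrier_mat)
qed

lemma perm_mat_cong:
  assumes "bij_betw e {..<d} X" "\<And>x. x \<in> X \<Longrightarrow> \<sigma> x = \<tau> x"
  shows "perm_mat d e \<sigma> = perm_mat d e \<tau>"
proof -
  have "\<sigma> (e j) = \<tau> (e j)" if "j < d" for j
    using assms that by (meson bij_betwE lessThan_iff)
  then show ?thesis
    by (auto simp: perm_mat_def)
qed


section \<open>A cyclic pairing\<close>

definition periodic :: "int \<Rightarrow> (int \<Rightarrow> 'a) \<Rightarrow> bool" where
  "periodic K u \<longleftrightarrow> (\<forall>i. u (i mod K) = u i)"

lemma periodicD: "periodic K u \<Longrightarrow> i mod K = j mod K \<Longrightarrow> u i = u j"
  unfolding periodic_def by metis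

lemma periodic_shift: "periodic K u \<Longrightarrow> periodic K (\<lambda>i. u (i - m))"
  unfolding periodic_def[of _ "\<lambda>i. u (i - m)"]
  by (auto intro!: periodicD[of K u] simp: mod_simps)

lemma finite_periodic:
  assumes "K > 0"
  shows "finite {u :: int \<Rightarrow> 'a::finite. periodic K u}"
proof (rule inj_on_finite)
  show "inj_on (\<lambda>u. restrict u {0..<K}) {u :: int \<Rightarrow> 'a. periodic K u}"
  proof (rule inj_onI, rule ext)
    fix u v :: "int \<Rightarrow> 'a" and i
    assume uv: "u \<in> {u. periodic K u}" "v \<in> {u. periodic K u}"
      and eq: "restrict u {0..<K} = restrict v {0..<K}"
    have "i mod K \<in> {0..<K}" using assms by simp
    then have "u (i mod K) = v (i mod K)"
      using eq by (metis restrict_apply')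
    then show "u i = v i"
      using uv by (simp add: periodic_def)
  qed
  show "(\<lambda>u. restrict u {0..<K}) ` {u :: int \<Rightarrow> 'a. periodic K u} \<subseteq> {0..<K} \<rightarrow>\<^sub>E UNIV"
    by auto
  show "finite ({0..<K} \<rightarrow>\<^sub>E (UNIV :: 'a set))"
    by (intro finite_PiE) auto
qed

lemma sum_periodic_shift:
  fixes h :: "int \<Rightarrow> 'a::comm_monoid_add"
  assumes "K > 0" "periodic K h"
  shows "(\<Sum>i\<in>{0..<K}. h (i - m)) = (\<Sum>i\<in>{0..<K}. h i)"
  by (rule sum.reindex_bij_witness[where i = "\<lambda>i. (i + m) mod K" and j = "\<lambda>i. (i - m) mod K"])
    (use assms in \<open>auto simp: mod_simps periodic_def\<close>)

text \<open>The commutator form of the extension is \<open>\<beta>(v, w) + \<beta>(w, v)\<close>. If \<open>M\<close> and \<open>-M\<close>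
  agreed modulo \<open>K\<close>, then \<open>\<beta>\<close> would be symmetric and this form zero, which is why the period is
  chosen different from \<open>2M\<close>.\<close>

definition cyclic_pairing :: "int \<Rightarrow> int \<Rightarrow> (int \<Rightarrow> bit) \<Rightarrow> (int \<Rightarrow> bit) \<Rightarrow> bit" where
  "cyclic_pairing K M v w = (\<Sum>i\<in>{0..<K}. v i * w (i + M))"

lemma cyclic_pairing_add_left:
  "cyclic_pairing K M (\<lambda>i. v i + v' i) w = cyclic_pairing K M v w + cyclic_pairing K M v' w"
  by (simp add: cyclic_pairing_def distrib_right sum.distrib)

lemma cyclic_pairing_add_right:
  "cyclic_pairing K M v (\<lambda>i. w i + w' i) = cyclic_pairing K M v w + cyclic_pairing K M v w'"
  by (simp add: cyclic_pairing_def distrib_left sum.distrib)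

lemma cyclic_pairing_zero [simp]:
  "cyclic_pairing K M (\<lambda>_. 0) w = 0" "cyclic_pairing K M v (\<lambda>_. 0) = 0"
  by (simp_all add: cyclic_pairing_def)

lemma cyclic_pairing_shift:
  assumes "K > 0" "periodic K v" "periodic K w"
  shows "cyclic_pairing K M (\<lambda>i. v (i - m)) (\<lambda>i. w (i - m)) = cyclic_pairing K M v w"
proof -
  have "periodic K (\<lambda>i. w (i - (- M)))"
    using assms(3) by (rule periodic_shift)
  then have "periodic K (\<lambda>i. v i * w (i + M))"
    using assms(2) by (simp add: periodic_def)
  from sum_periodic_shift[OF assms(1) this, of m] show ?thesis
    by (simp add: cyclic_pairing_def algebra_simps)
qed


section \<open>Lamp configurations modulo a period\<close>

text \<open>The homomorphism that pushes a finitely supported configuration forward along \<open>\<int> \<rightarrow> \<int>/K\<close>,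
  lamps in the same residue class being added up. As a homomorphism it commutes with shifts
  everywhere, not only inside a window.\<close>

definition wrap :: "int \<Rightarrow> (int \<Rightarrow> bit) \<Rightarrow> int \<Rightarrow> bit" where
  "wrap K f i = (\<Sum>j | f j \<noteq> 0 \<and> j mod K = i mod K. f j)"

lemma periodic_wrap: "periodic K (wrap K f)"
  by (simp add: periodic_def wrap_def)

lemma wrap_eq:
  assumes "finite F" "{i. f i \<noteq> 0} \<subseteq> F"
  shows "wrap K f i = (\<Sum>j\<in>{j \<in> F. j mod K = i mod K}. f j)"
  unfolding wrap_def by (rule sum.mono_neutral_left) (use assms in auto)

lemma wrap_add:
  assumes "finite {i. f i \<noteq> 0}" "finite {i. g i \<noteq> 0}"
  shows "wrap K (\<lambda>i. f i + g i) i = wrap K f i + wrap K g i"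
proof -
  let ?F = "{i. f i \<noteq> 0} \<union> {i. g i \<noteq> 0}"
  have F: "finite ?F" using assms by blast
  have "{i. f i + g i \<noteq> 0} \<subseteq> ?F" by auto
  then show ?thesis
    by (simp add: wrap_eq[OF F] sum.distrib)
qed

lemma wrap_shift: "wrap K (\<lambda>i. f (i - m)) i = wrap K f (i - m)"
  unfolding wrap_def
  by (rule sum.reindex_bij_witness[where i = "\<lambda>j. j + m" and j = "\<lambda>j. j - m"])
    (auto simp: mod_eq_dvd_iff algebra_simps)

lemma wrap_nonzeroE:
  assumes "wrap K f i \<noteq> 0"
  obtains j where "f j \<noteq> 0" "j mod K = i mod K"
  using assms unfolding wrap_def by (auto elim: sum.not_neutral_contains_not_neutral)

lemma wrap_zero [simp]: "wrap K (\<lambda>_. 0) = (\<lambda>_. 0)"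
  by (simp add: wrap_def fun_eq_iff)

lemma wrap_delta: "wrap K (\<lambda>i. if i = n then 1 else 0) i = (if i mod K = n mod K then 1 else 0)"
  by (subst wrap_eq[of "{n}"]) (auto simp: Collect_conv_if)

text \<open>Two positions in the window \<open>[-r, r]\<close> differ by at most \<open>2r\<close>, so they can differ by \<open>2r + 1\<close>
  modulo \<open>K\<close> only by going around the cycle, for which \<open>K > 4r + 2\<close> leaves no room.\<close>

lemma cyclic_pairing_window:
  assumes K: "K > 4 * r + 2" and r: "r \<ge> 0"
    and f: "\<And>i. f i \<noteq> 0 \<Longrightarrow> \<bar>i\<bar> \<le> r" and g: "\<And>i. g i \<noteq> 0 \<Longrightarrow> \<bar>i\<bar> \<le> r"
  shows "cyclic_pairing K (2 * r + 1) (wrap K f) (wrap K g) = 0"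
  unfolding cyclic_pairing_def
proof (rule sum.neutral, rule ballI, rule ccontr)
  fix i assume "wrap K f i * wrap K g (i + (2 * r + 1)) \<noteq> 0"
  then have "wrap K f i \<noteq> 0" "wrap K g (i + (2 * r + 1)) \<noteq> 0" by auto
  then obtain j j' where j: "f j \<noteq> 0" "j mod K = i mod K"
    and j': "g j' \<noteq> 0" "j' mod K = (i + (2 * r + 1)) mod K"
    by (metis wrap_nonzeroE)
  have "K dvd (j - i) - (j' - (i + (2 * r + 1)))"
    using j(2) j'(2) unfolding mod_eq_dvd_iff by (rule dvd_diff)
  then have "K dvd j + (2 * r + 1) - j'" by (simp add: algebra_simps)
  moreover have "0 < j + (2 * r + 1) - j'" "j + (2 * r + 1) - j' < K"
    using f[OF j(1)] g[OF j'(1)] K by auto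
  ultimately show False
    using zdvd_not_zless by blast
qed


section \<open>Twisted shifts\<close>

text \<open>The pair \<open>(v, 0)\<close> in the central extension acts by left multiplication after the shift by \<open>m\<close>.
  Points \<open>(u, c)\<close> are the elements of the extension, with configurations modulo \<open>K\<close> encoded as
  periodic functions, for which the shift is just a translation of the argument.\<close>

definition twisted_shift ::
  "int \<Rightarrow> int \<Rightarrow> (int \<Rightarrow> bit) \<Rightarrow> int \<Rightarrow> (int \<Rightarrow> bit) \<times> bit \<Rightarrow> (int \<Rightarrow> bit) \<times> bit" where
  "twisted_shift K M v m =
     (\<lambda>(u, c). (\<lambda>i. v i + u (i - m), c + cyclic_pairing K M v (\<lambda>i. u (i - m))))"

definition twisted_space :: "int \<Rightarrow> ((int \<Rightarrow> bit) \<times> bit) set" where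
  "twisted_space K = {u. periodic K u} \<times> UNIV"

lemma UNIV_bit: "(UNIV :: bit set) = {0, 1}"
  using bit.exhaust by auto

instance bit :: finite
  by standard (simp add: UNIV_bit)

lemma finite_twisted_space: "K > 0 \<Longrightarrow> finite (twisted_space K)"
  unfolding twisted_space_def by (intro finite_cartesian_product finite_periodic finite)

lemma twisted_shift_closed:
  assumes "periodic K v"
  shows "twisted_shift K M v m \<in> twisted_space K \<rightarrow> twisted_space K"
proof
  fix p assume "p \<in> twisted_space K"
  then obtain u c where p: "p = (u, c)" "periodic K u"
    by (auto simp: twisted_space_def)
  from periodic_shift[OF p(2), of m] show "twisted_shift K M v m p \<in> twisted_space K"
    using assms p(1) by (simp add: twisted_shift_def twisted_space_def periodic_def)
qed

lemma inj_twisted_shift: "inj (twisted_shift K M v m)"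
proof (rule injI)
  fix p q assume eq: "twisted_shift K M v m p = twisted_shift K M v m q"
  obtain u c u' c' where p: "p = (u, c)" "q = (u', c')" by fastforce
  have "u (i - m) = u' (i - m)" for i
    using eq by (auto simp: p twisted_shift_def fun_eq_iff)
  from this[of "_ + m"] have "u = u'" by (simp add: fun_eq_iff)
  then show "p = q"
    using eq by (auto simp: p twisted_shift_def)
qed

text \<open>In general the product of two elements of the section picks up the cocycle \<open>\<beta>(v, w(\<cdot> - m))\<close>
  in the centre, and it is this term that is assumed to vanish.\<close>

lemma twisted_shift_comp:
  assumes K: "K > 0" and w: "periodic K w" and p: "p \<in> twisted_space K"
    and pair: "cyclic_pairing K M v (\<lambda>i. w (i - m)) = 0"
  shows "twisted_shift K M v m (twisted_shift K M w n p) =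
    twisted_shift K M (\<lambda>i. v i + w (i - m)) (m + n) p"
proof -
  obtain u c where u: "p = (u, c)" "periodic K u"
    using p by (auto simp: twisted_space_def)
  have idx: "i - (m + n) = i - m - n" for i :: int by simp
  have "cyclic_pairing K M w (\<lambda>i. u (i - n)) =
      cyclic_pairing K M (\<lambda>i. w (i - m)) (\<lambda>i. u (i - m - n))"
    using cyclic_pairing_shift[OF K w periodic_shift[OF u(2), of n], of M m] by simp
  then show ?thesis
    by (simp add: u twisted_shift_def idx cyclic_pairing_add_left cyclic_pairing_add_right pair
        add_ac)
qed

text \<open>Both products have the same first component; the second components differ by
  \<open>\<beta>(v, w) - \<beta>(w, v) = 1\<close>. The term \<open>\<beta>(w, v)\<close> would contribute only if \<open>M\<close> and \<open>-M\<close>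
  agreed modulo \<open>K\<close>.\<close>

lemma twisted_shift_not_commute:
  fixes K M :: int
  defines "v \<equiv> wrap K (\<lambda>i. if i = 0 then 1 else 0)" and "w \<equiv> wrap K (\<lambda>i. if i = M then 1 else 0)"
  assumes K: "K > 0" and M: "\<not> K dvd 2 * M"
  shows "twisted_shift K M v 0 (twisted_shift K M w 0 p) \<noteq>
    twisted_shift K M w 0 (twisted_shift K M v 0 p)"
proof -
  obtain u c where p: "p = (u, c)" by fastforce
  have "cyclic_pairing K M v w = (\<Sum>i\<in>{0..<K}. if i = 0 then 1 else 0)"
    unfolding cyclic_pairing_def
    by (rule sum.cong) (auto simp: v_def w_def wrap_delta)
  then have vw: "cyclic_pairing K M v w = 1" using K by simp
  have disjoint: "K dvd 2 * M" if "i mod K = M mod K" "(i + M) mod K = 0" for i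
  proof -
    have "K dvd i + M" "K dvd i - M"
      using that by (simp_all add: mod_eq_dvd_iff mod_eq_0_iff_dvd)
    then have "K dvd (i + M) - (i - M)"
      by (rule dvd_diff)
    then show ?thesis by simp
  qed
  have wv: "cyclic_pairing K M w v = 0"
    unfolding cyclic_pairing_def
  proof (rule sum.neutral, rule ballI)
    fix i
    show "w i * v (i + M) = 0"
      using disjoint[of i] M by (auto simp: v_def w_def wrap_delta)
  qed
  show ?thesis
    using vw wv by (simp add: p twisted_shift_def cyclic_pairing_add_right add_ac)
qed


section \<open>Partial representations of the lamplighter group\<close>

lemma lamp_mult:
  "x \<otimes>\<^bsub>lamplighter\<^esub> y = (\<lambda>i. fst x i + fst y (i - snd x), snd x + snd y)"
  by (simp add: lamplighter_def case_prod_unfold)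

lemma lamp_carrier: "x \<in> carrier lamplighter \<longleftrightarrow> finite {i. fst x i \<noteq> 0}"
  by (cases x) (simp add: lamplighter_def)

lemma lamp_ball_support:
  assumes x: "x \<in> word_ball lamplighter {lamp_a, lamp_t} r" and i: "fst x i \<noteq> 0"
  shows "\<bar>i\<bar> \<le> int r"
proof -
  interpret group lamplighter by (rule group_lamplighter)
  have inv_a: "inv\<^bsub>lamplighter\<^esub> lamp_a = lamp_a"
    using lamplighter_relations(1) lamp_gens_closed by (intro inv_equality) auto
  have inv_t: "inv\<^bsub>lamplighter\<^esub> lamp_t = (\<lambda>_. 0, - 1)"
    by (rule inv_equality) (auto simp: lamp_mult lamp_t_def lamp_carrier lamplighter_def)
  have "\<bar>i\<bar> \<le> int (length w)"
    if "w \<in> lists {lamp_a, lamp_t, (\<lambda>_. 0, - 1)}"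
      "fst (foldr (monoid.mult lamplighter) w \<one>\<^bsub>lamplighter\<^esub>) i \<noteq> 0" for w i
    using that
  proof (induction w arbitrary: i rule: lists.induct)
    case Nil
    then show ?case by (simp add: lamplighter_def)
  next
    case (Cons s w)
    let ?g = "foldr (monoid.mult lamplighter) w \<one>\<^bsub>lamplighter\<^esub>"
    have step: "fst s i + fst ?g (i - snd s) \<noteq> 0"
      using Cons.prems by (simp add: lamp_mult[of s ?g])
    from Cons.hyps(1) consider "s = lamp_a" | "s = lamp_t" | "s = (\<lambda>_. 0, - 1)" by auto
    then show ?case
    proof cases
      case 1
      then have "i = 0 \<or> fst ?g i \<noteq> 0"
        using step by (auto simp: lamp_a_def)
      then show ?thesis
        using Cons.IH[of i] by auto
    next
      case 2
      then show ?thesis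
        using step Cons.IH[of "i - 1"] by (simp add: lamp_t_def)
    next
      case 3
      then show ?thesis
        using step Cons.IH[of "i + 1"] by simp
    qed
  qed
  moreover obtain w where "w \<in> lists {lamp_a, lamp_t, (\<lambda>_. 0, - 1)}" "length w \<le> r"
      "foldr (monoid.mult lamplighter) w \<one>\<^bsub>lamplighter\<^esub> = x"
    using x by (auto simp: word_ball_iff[OF lamp_gens_closed] inv_a inv_t insert_commute)
  ultimately have "\<bar>i\<bar> \<le> int (length w)" using i by blast
  then show ?thesis
    using \<open>length w \<le> r\<close> by simp
qed

definition lamp_perm :: "int \<Rightarrow> int \<Rightarrow> (int \<Rightarrow> bit) \<times> int \<Rightarrow> (int \<Rightarrow> bit) \<times> bit \<Rightarrow> (int \<Rightarrow> bit) \<times> bit" where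
  "lamp_perm K M x = twisted_shift K M (wrap K (fst x)) (snd x)"

lemma lamp_perm_comp:
  assumes K: "K > 0" and x: "x \<in> carrier lamplighter" and y: "y \<in> carrier lamplighter"
    and p: "p \<in> twisted_space K"
    and pair: "cyclic_pairing K M (wrap K (fst x)) (wrap K (\<lambda>i. fst y (i - snd x))) = 0"
  shows "lamp_perm K M x (lamp_perm K M y p) = lamp_perm K M (x \<otimes>\<^bsub>lamplighter\<^esub> y) p"
proof -
  have "{i. fst y (i - snd x) \<noteq> 0} \<subseteq> (\<lambda>i. i + snd x) ` {i. fst y i \<noteq> 0}"
    by (force simp: image_iff)
  then have fin: "finite {i. fst y (i - snd x) \<noteq> 0}"
    using y unfolding lamp_carrier by (meson finite_imageI finite_subset)
  have shift: "wrap K (\<lambda>i. fst y (i - snd x)) = (\<lambda>i. wrap K (fst y) (i - snd x))"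
    by (rule ext) (rule wrap_shift)
  have "wrap K (fst (x \<otimes>\<^bsub>lamplighter\<^esub> y)) = (\<lambda>i. wrap K (fst x) i + wrap K (fst y) (i - snd x))"
    using x fin by (intro ext) (simp add: lamp_mult lamp_carrier wrap_add wrap_shift)
  then show ?thesis
    using twisted_shift_comp[OF K periodic_wrap p, of M "wrap K (fst x)" "fst y" "snd x" "snd y"] pair
    by (simp add: lamp_perm_def shift lamp_mult)
qed

definition lamp_at :: "int \<Rightarrow> (int \<Rightarrow> bit) \<times> int" where
  "lamp_at n = (\<lambda>i. if i = n then 1 else 0, 0)"

lemma lamp_at_carrier: "lamp_at n \<in> carrier lamplighter"
  by (simp add: lamp_carrier lamp_at_def)

lemma lamp_at_0: "lamp_at 0 = lamp_a"
  by (simp add: lamp_at_def lamp_a_def)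

lemma lamp_at_commute:
  "lamp_at m \<otimes>\<^bsub>lamplighter\<^esub> lamp_at n = lamp_at n \<otimes>\<^bsub>lamplighter\<^esub> lamp_at m"
  by (simp add: lamp_mult lamp_at_def add.commute)

lemma lamp_at_conj:
  "lamp_at (n + 1) \<otimes>\<^bsub>lamplighter\<^esub> lamp_t = lamp_t \<otimes>\<^bsub>lamplighter\<^esub> lamp_at n"
  by (auto simp: lamp_mult lamp_at_def lamp_t_def fun_eq_iff)

lemma hom_unitary_mult:
  assumes "\<pi> \<in> hom lamplighter (unitary_group d)" "x \<in> carrier lamplighter" "y \<in> carrier lamplighter"
  shows "\<pi> (x \<otimes>\<^bsub>lamplighter\<^esub> y) = \<pi> x * \<pi> y"
  using hom_mult[OF assms] by (simp add: unitary_group_def)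

text \<open>The matrices \<open>B n\<close> imitate \<open>\<pi> (lamp_at n)\<close>. Each further conjugation by \<open>t\<close> adds \<open>2\<kappa>\<close> to the
  error, and the commutator contains \<open>B 0\<close> and \<open>B n\<close> twice each: in total
  \<open>2 (\<kappa> + (2n + 1) \<kappa>)\<close>.\<close>

lemma hs_norm_commutator_le:
  assumes \<pi>: "\<pi> \<in> hom lamplighter (unitary_group d)"
    and B: "\<And>n. B n \<in> carrier (unitary_group d)" and T: "T \<in> carrier (unitary_group d)"
    and conj: "\<And>n. B (n + 1) * T = T * B n"
    and a: "hs_norm (B 0 - \<pi> lamp_a) < \<kappa>" and t: "hs_norm (T - \<pi> lamp_t) < \<kappa>"
  shows "hs_norm (B 0 * B (int n) - B (int n) * B 0) \<le> (4 * real n + 4) * \<kappa>"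
proof -
  have \<pi>u: "\<pi> x \<in> carrier (unitary_group d)" if "x \<in> carrier lamplighter" for x
    using \<pi> that by (rule hom_in_carrier)
  have car: "U \<in> carrier_mat d d" if "U \<in> carrier (unitary_group d)" for U
    using that by (simp add: unitary_group_carrier)
  have at: "lamp_t \<in> carrier lamplighter"
    using lamp_gens_closed by blast
  have near: "hs_norm (B (int k) - \<pi> (lamp_at (int k))) \<le> (2 * real k + 1) * \<kappa>" for k
  proof (induction k)
    case 0
    then show ?case using a by (simp add: lamp_at_0)
  next
    case (Suc k)
    have "\<pi> (lamp_at (int k + 1)) * \<pi> lamp_t = \<pi> lamp_t * \<pi> (lamp_at (int k))"
      using lamp_at_conj[of "int k"] hom_unitary_mult[OF \<pi>] lamp_at_carrier at by metis
    from hs_norm_unitary_conj_diff[OF B T car[OF B] car[OF \<pi>u[OF lamp_at_carrier]]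
        \<pi>u[OF at] \<pi>u[OF lamp_at_carrier] conj[of "int k"] this]
    show ?case
      using Suc t by (simp add: algebra_simps)
  qed
  let ?A = "B 0" and ?B = "B (int n)" and ?A' = "\<pi> (lamp_at 0)" and ?B' = "\<pi> (lamp_at (int n))"
  have u: "?A' \<in> carrier (unitary_group d)" "?B' \<in> carrier (unitary_group d)"
    by (rule \<pi>u, rule lamp_at_carrier)+
  have comm: "?A' * ?B' = ?B' * ?A'"
    using lamp_at_commute[of 0 "int n"] hom_unitary_mult[OF \<pi>] lamp_at_carrier by metis
  have "hs_norm (?A * ?B - ?B * ?A) \<le> hs_norm (?A * ?B - ?A' * ?B') + hs_norm (?A' * ?B' - ?B * ?A)"
    by (rule hs_norm_triangle[of _ d]) (intro mult_carrier_mat[of _ d d _ d] car B u)+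
  also have "hs_norm (?A' * ?B' - ?B * ?A) = hs_norm (?B * ?A - ?B' * ?A')"
    unfolding comm by (rule hs_norm_commute[of _ d]) (intro mult_carrier_mat[of _ d d _ d] car B u)+
  also have "hs_norm (?A * ?B - ?A' * ?B') \<le> hs_norm (?A - ?A') + hs_norm (?B - ?B')"
    by (rule hs_norm_mult_diff[of _ d]) (auto intro: car B u)
  also have "hs_norm (?B * ?A - ?B' * ?A') \<le> hs_norm (?B - ?B') + hs_norm (?A - ?A')"
    by (rule hs_norm_mult_diff[of _ d]) (auto intro: car B u)
  finally show ?thesis
    using near[of 0] near[of n] by (simp add: algebra_simps)
qed

lemma partial_representation:
  obtains d \<phi> where "d \<ge> 1" "\<phi> \<in> carrier lamplighter \<rightarrow> carrier (unitary_group d)"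
    "local_defect lamplighter {lamp_a, lamp_t} r \<phi> = 0"
    "global_defect lamplighter {lamp_a, lamp_t} d \<phi> \<ge> 1 / (8 * real r + 8)"
proof -
  interpret group lamplighter by (rule group_lamplighter)
  define M where "M = 2 * int r + 1"
  define K where "K = 4 * int r + 3"
  have K0: "K > 0" by (simp add: K_def)
  define X where "X = twisted_space K"
  define d where "d = card X"
  have "finite X" unfolding X_def using K0 by (rule finite_twisted_space)
  moreover have "(\<lambda>_. 0, 0) \<in> X"
    by (simp add: X_def twisted_space_def periodic_def)
  ultimately have d: "d \<ge> 1" and "\<exists>e. bij_betw e {0..<d} X"
    unfolding d_def by (auto simp: Suc_le_eq card_gt_0_iff intro: ex_bij_betw_nat_finite)
  then obtain e where e: "bij_betw e {..<d} X"
    by (auto simp: atLeast0LessThan)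
  define \<phi> where "\<phi> x = perm_mat d e (lamp_perm K M x)" for x
  have maps: "lamp_perm K M x \<in> X \<rightarrow> X" for x
    unfolding lamp_perm_def X_def by (rule twisted_shift_closed[OF periodic_wrap])
  have u: "\<phi> x \<in> carrier (unitary_group d)" for x
    unfolding \<phi>_def
    by (rule perm_mat_unitary[OF e maps]) (simp add: lamp_perm_def inj_on_subset[OF inj_twisted_shift])
  have mult: "\<phi> x * \<phi> y = \<phi> (x \<otimes>\<^bsub>lamplighter\<^esub> y)"
    if "x \<in> carrier lamplighter" "y \<in> carrier lamplighter"
      "cyclic_pairing K M (wrap K (fst x)) (wrap K (\<lambda>i. fst y (i - snd x))) = 0" for x y
    unfolding \<phi>_def perm_mat_mult[OF e maps]
    by (rule perm_mat_cong[OF e]) (simp add: lamp_perm_comp[OF K0 that(1,2) _ that(3)] X_def)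
  have "local_defect lamplighter {lamp_a, lamp_t} r \<phi> = 0"
  proof -
    let ?W = "word_ball lamplighter {lamp_a, lamp_t} r"
    have zero: "hs_norm (\<phi> (g \<otimes>\<^bsub>lamplighter\<^esub> h) - \<phi> g * \<phi> h) = 0"
      if W: "g \<in> ?W" "h \<in> ?W" "g \<otimes>\<^bsub>lamplighter\<^esub> h \<in> ?W" for g h
    proof -
      \<comment> \<open>The lamps of \<open>h\<close>, translated by the position of \<open>g\<close>, could leave the window; but a lamp
        outside it could not be switched off by \<open>g\<close> and would be visible in the product.\<close>
      have "\<bar>i\<bar> \<le> int r" if "fst h (i - snd g) \<noteq> 0" for i
      proof (cases "fst g i = 0")
        case True
        then have "fst (g \<otimes>\<^bsub>lamplighter\<^esub> h) i \<noteq> 0"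
          using that by (simp add: lamp_mult)
        then show ?thesis by (rule lamp_ball_support[OF W(3)])
      qed (rule lamp_ball_support[OF W(1)])
      then have "cyclic_pairing K M (wrap K (fst g)) (wrap K (\<lambda>i. fst h (i - snd g))) = 0"
        unfolding M_def by (intro cyclic_pairing_window) (auto simp: K_def intro: lamp_ball_support[OF W(1)])
      then have "\<phi> g * \<phi> h = \<phi> (g \<otimes>\<^bsub>lamplighter\<^esub> h)"
        using W by (intro mult) (auto simp: word_ball_def)
      then show ?thesis
        using u[of "g \<otimes>\<^bsub>lamplighter\<^esub> h"]
        by (simp add: unitary_group_carrier minus_r_inv_mat[of _ d d] hs_norm_zero)
    qed
    have one: "\<one>\<^bsub>lamplighter\<^esub> \<in> ?W"
      unfolding word_ball_iff[OF lamp_gens_closed] by (rule bexI[of _ "[]"]) simp_all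
    have "{hs_norm (\<phi> (g \<otimes>\<^bsub>lamplighter\<^esub> h) - \<phi> g * \<phi> h) | g h.
        g \<in> ?W \<and> h \<in> ?W \<and> g \<otimes>\<^bsub>lamplighter\<^esub> h \<in> ?W} = {0}" (is "?S = _")
    proof (intro equalityI subsetI)
      fix x assume "x \<in> ?S"
      then show "x \<in> {0}" using zero by blast
    next
      fix x :: real assume "x \<in> {0}"
      then have "x = hs_norm (\<phi> (\<one>\<^bsub>lamplighter\<^esub> \<otimes>\<^bsub>lamplighter\<^esub> \<one>\<^bsub>lamplighter\<^esub>) -
          \<phi> \<one>\<^bsub>lamplighter\<^esub> * \<phi> \<one>\<^bsub>lamplighter\<^esub>)"
        using zero[OF one one] one by simp
      then show "x \<in> ?S"
        by (intro CollectI exI[of _ "\<one>\<^bsub>lamplighter\<^esub>"] conjI) (simp_all add: one)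
    qed
    then show ?thesis by (simp add: local_defect_def)
  qed
  moreover have "global_defect lamplighter {lamp_a, lamp_t} d \<phi> \<ge> 1 / (8 * real r + 8)"
    unfolding global_defect_def
  proof (rule cINF_greatest)
    have "mat_adjoint (1\<^sub>m d) = (1\<^sub>m d :: complex mat)"
      by (rule eq_matI) auto
    then have "(\<lambda>_. 1\<^sub>m d) \<in> hom lamplighter (unitary_group d)"
      by (simp add: hom_def unitary_group_def)
    then show "hom lamplighter (unitary_group d) \<noteq> {}" by blast
  next
    fix \<pi> assume \<pi>: "\<pi> \<in> hom lamplighter (unitary_group d)"
    let ?D = "Max ((\<lambda>g. hs_norm (\<phi> g - \<pi> g)) ` {lamp_a, lamp_t})"
    have lt: "lamp_t \<in> carrier lamplighter" using lamp_gens_closed by blast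
    have fst_t: "fst lamp_t = (\<lambda>_. 0)" by (simp add: lamp_t_def)
    have conj: "\<phi> (lamp_at (n + 1)) * \<phi> lamp_t = \<phi> lamp_t * \<phi> (lamp_at n)" for n
    proof -
      have "\<phi> (lamp_at (n + 1)) * \<phi> lamp_t = \<phi> (lamp_at (n + 1) \<otimes>\<^bsub>lamplighter\<^esub> lamp_t)"
        by (rule mult) (simp_all add: lamp_at_carrier lt fst_t)
      moreover have "\<phi> lamp_t * \<phi> (lamp_at n) = \<phi> (lamp_t \<otimes>\<^bsub>lamplighter\<^esub> lamp_at n)"
        by (rule mult) (simp_all add: lamp_at_carrier lt fst_t)
      ultimately show ?thesis by (simp add: lamp_at_conj)
    qed
    have ndvd: "\<not> K dvd 2 * M"
      using zdvd_not_zless[of "2 * M" K] by (simp add: K_def M_def)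
    have far: "hs_norm (\<phi> (lamp_at 0) * \<phi> (lamp_at M) - \<phi> (lamp_at M) * \<phi> (lamp_at 0)) \<ge> 1"
      unfolding \<phi>_def perm_mat_mult[OF e maps]
    proof (rule hs_norm_perm_mat_diff[OF e])
      show "lamp_perm K M (lamp_at 0) \<circ> lamp_perm K M (lamp_at M) \<in> X \<rightarrow> X"
      proof
        fix p assume "p \<in> X"
        then have "lamp_perm K M (lamp_at 0) (lamp_perm K M (lamp_at M) p) \<in> X"
          by (intro funcset_mem[OF maps])
        then show "(lamp_perm K M (lamp_at 0) \<circ> lamp_perm K M (lamp_at M)) p \<in> X"
          by simp
      qed
      show "(lamp_perm K M (lamp_at 0) \<circ> lamp_perm K M (lamp_at M)) p \<noteq>
          (lamp_perm K M (lamp_at M) \<circ> lamp_perm K M (lamp_at 0)) p" for p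
        using twisted_shift_not_commute[OF K0 ndvd, of p] by (simp add: lamp_perm_def lamp_at_def)
    qed (use d in simp)
    show "1 / (8 * real r + 8) \<le> ?D"
    proof (rule ccontr)
      assume "\<not> 1 / (8 * real r + 8) \<le> ?D"
      then have "?D < 1 / (8 * real r + 8)" by (rule not_le_imp_less)
      from dense[OF this] obtain \<kappa> where \<kappa>: "?D < \<kappa>" "\<kappa> < 1 / (8 * real r + 8)"
        by (elim exE conjE)
      have "hs_norm (\<phi> (lamp_at 0) - \<pi> lamp_a) < \<kappa>" "hs_norm (\<phi> lamp_t - \<pi> lamp_t) < \<kappa>"
        using \<kappa>(1) by (auto simp: lamp_at_0)
      from hs_norm_commutator_le[OF \<pi> u u conj this, of "2 * r + 1"] far
      have "1 \<le> (8 * real r + 8) * \<kappa>"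
        by (simp add: M_def algebra_simps)
      then show False
        using \<kappa>(2) by (simp add: field_simps)
    qed
  qed
  moreover have "\<phi> \<in> carrier lamplighter \<rightarrow> carrier (unitary_group d)"
    using u by (rule Pi_I)
  ultimately show ?thesis
    by (intro that[OF d])
qed

lemma stability_rate_zero:
  assumes "\<kappa> \<le> 1 / (8 * real r + 8)"
  shows "stability_rate lamplighter {lamp_a, lamp_t} r \<kappa> = 0"
proof -
  obtain d \<phi> where \<phi>: "d \<ge> 1" "\<phi> \<in> carrier lamplighter \<rightarrow> carrier (unitary_group d)"
    "local_defect lamplighter {lamp_a, lamp_t} r \<phi> = 0"
    "global_defect lamplighter {lamp_a, lamp_t} d \<phi> \<ge> 1 / (8 * real r + 8)"
    by (rule partial_representation)
  have ball: "\<phi> \<in> word_ball lamplighter {lamp_a, lamp_t} r \<rightarrow> carrier (unitary_group d)"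
    using \<phi>(2) by (auto simp: word_ball_def)
  have "\<not> (\<forall>d\<ge>1. \<forall>\<phi> \<in> word_ball lamplighter {lamp_a, lamp_t} r \<rightarrow> carrier (unitary_group d).
      local_defect lamplighter {lamp_a, lamp_t} r \<phi> < \<delta> \<longrightarrow>
      global_defect lamplighter {lamp_a, lamp_t} d \<phi> < \<kappa>)" if "\<delta> > 0" for \<delta>
  proof
    assume "\<forall>d\<ge>1. \<forall>\<phi> \<in> word_ball lamplighter {lamp_a, lamp_t} r \<rightarrow> carrier (unitary_group d).
        local_defect lamplighter {lamp_a, lamp_t} r \<phi> < \<delta> \<longrightarrow>
        global_defect lamplighter {lamp_a, lamp_t} d \<phi> < \<kappa>"
    from this[rule_format, OF \<phi>(1) ball] have "global_defect lamplighter {lamp_a, lamp_t} d \<phi> < \<kappa>"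
      using \<phi>(3) that by simp
    then show False
      using \<phi>(4) assms by linarith
  qed
  then have empty: "{\<delta>::real. \<delta> > 0 \<and>
      (\<forall>d\<ge>1. \<forall>\<phi> \<in> word_ball lamplighter {lamp_a, lamp_t} r \<rightarrow> carrier (unitary_group d).
          local_defect lamplighter {lamp_a, lamp_t} r \<phi> < \<delta> \<longrightarrow>
          global_defect lamplighter {lamp_a, lamp_t} d \<phi> < \<kappa>)} = {}"
    by blast
  then show ?thesis
    unfolding stability_rate_def empty by (simp add: bot_ennreal)
qed

theorem propositionA1:
  shows "\<exists>C::real. C \<ge> 1 \<and>
    (\<forall>x::real. x > 0 \<longrightarrow>
      ennreal x \<le> ennreal C * ennreal_of_enat (stability_radius lamplighter {lamp_a, lamp_t} (C * x)))"
proof (intro exI[of _ 4] conjI allI impI)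
  fix x :: real assume x: "x > 0"
  let ?R = "{r::nat. r \<ge> 1 \<and> stability_rate lamplighter {lamp_a, lamp_t} r (1 / (4 * x)) > 0}"
  have bound: "x \<le> 4 * real r" if "r \<in> ?R" for r
  proof (rule ccontr)
    assume "\<not> x \<le> 4 * real r"
    \<comment> \<open>Here \<open>r \<ge> 1\<close> gives \<open>8r + 8 \<le> 16r < 4x\<close>, whence the constant \<open>4\<close>.\<close>
    then have "8 * real r + 8 \<le> 4 * x" using that by auto
    then have "1 / (4 * x) \<le> 1 / (8 * real r + 8)"
      by (intro divide_left_mono) (use x in auto)
    then show False
      using that stability_rate_zero by auto
  qed
  show "ennreal x \<le> ennreal 4 *
      ennreal_of_enat (stability_radius lamplighter {lamp_a, lamp_t} (4 * x))"
  proof (cases "?R = {}")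
    case True
    then show ?thesis
      unfolding stability_radius_def True by (simp add: top_enat_def ennreal_mult_top)
  next
    case False
    then obtain r0 where "r0 \<in> ?R" by blast
    then have "stability_radius lamplighter {lamp_a, lamp_t} (4 * x) \<in> enat ` ?R"
      unfolding stability_radius_def by (intro wellorder_InfI[of "enat r0"] imageI)
    then obtain r where r: "r \<in> ?R" "stability_radius lamplighter {lamp_a, lamp_t} (4 * x) = enat r"
      by auto
    have "ennreal x \<le> ennreal (4 * real r)"
      using bound[OF r(1)] by (rule ennreal_leI)
    then show ?thesis
      by (simp add: r(2) ennreal_mult' ennreal_of_nat_eq_real_of_nat)
  qed
qed simp

end
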